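(* (1) Every non-synchronous instance $(r,x,y,\phi,\tau,v,t,\chi)$ (i.e. with $\tau\neq1$ or $v\neq1$) is feasible. (2) A synchronous instance $(r,x,y,\phi,\tau,v,t,\chi)$ (i.e. with $\tau=v=1$) is feasible if and only if (a) $\chi=1$ and $\phi\neq0$, or (b) $\chi=1$, $\phi=0$ and $t\ge \mathrm{dist}((0,0),(x,y))-r$, or (c) $\chi=-1$ and $t\ge\mathrm{dist}(proj_A,proj_B)-r$.
   Context: Model. Two agents $A$ and $B$ are points moving in the plane. Everything is expressed in the system of agent $A$: its Cartesian coordinate system (origin at its start point), its time unit, its length unit, speed $1$, wake-up at time $0$. An instance is a tuple $(r,x,y,\phi,\tau,v,t,\chi)$: $r>0$ is the visibility radius; $(x,y)\neq(0,0)$ is the initial position of $B$; $0\le\phi<2\pi$ is such that $B$'s positive $x$-axis points in direction at angle $\phi$ (counterclockwise) from $A$'s $x$-axis; $\chi=+1$ if $B$'s positive $y$-axis then points in direction $\phi+\pi/2$ and $\chi=-1$ if it points in direction $\phi-\pi/2$; $\tau>0$ is the duration of $B$'s time unit; $v>0$ is $B$'s speed; $t\ge0$ is $B$'s wake-up time (idle at its initial position before). $B$'s length unit is $\tau v$. Both agents execute the same deterministic algorithm made of instructions "go in direction $\theta$ (private coordinates) a distance $d$ (private length units)" and "wait $z$ private time units"; behaviour may depend only on the algorithm, private clock/coordinates and whether the other agent has been sensed within distance $r$ (agents do not know which of them is $A$). Rendezvous occurs when the agents are at distance at most $r$ and never move afterwards. An instance is feasible if there exists a deterministic algorithm (possibly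 designed specifically for this instance) which, executed by both agents, guarantees rendezvous. Synchronous means $\tau=v=1$. The canonical line $L$ is the line through the midpoint of $(0,0)$ and $(x,y)$ making angle $\phi/2$ with $A$'s $x$-axis. $proj_A$, $proj_B$ are the orthogonal projections on $L$ of the initial positions of $A$, $B$; $\mathrm{dist}$ is Euclidean distance. *)

theory Defs
  imports "HOL-Analysis.Analysis"
begin

text \<open>The plane is \<^typ>\<open>complex\<close>, with agent A starting at 0. All quantities of an instance are
  expressed in the system of A, whose length unit, time unit and speed are 1.\<close>

record rv_instance =
  radius :: real
  start_x :: real
  start_y :: real
  axis_angle :: real
  time_unit :: real
  speed :: real
  wakeup :: real
  chirality :: int

definition valid_instance :: "rv_instance \<Rightarrow> bool" where
  "valid_instance I \<longleftrightarrow>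
     radius I > 0 \<and> (start_x I, start_y I) \<noteq> (0, 0) \<and>
     0 \<le> axis_angle I \<and> axis_angle I < 2 * pi \<and>
     time_unit I > 0 \<and> speed I > 0 \<and> wakeup I \<ge> 0 \<and> chirality I \<in> {1, -1}"

definition synchronous :: "rv_instance \<Rightarrow> bool" where
  "synchronous I \<longleftrightarrow> time_unit I = 1 \<and> speed I = 1"

definition start_B :: "rv_instance \<Rightarrow> complex" where
  "start_B I = Complex (start_x I) (start_y I)"

text \<open>\<open>Go \<theta> d\<close>: move a distance \<open>d\<close> in direction \<open>\<theta>\<close>; \<open>Wait z\<close>: stay idle for time \<open>z\<close>. Both are in
  private units. The private length unit is what the agent covers in one private time unit, so in
  private units every agent has speed 1 and \<open>Go \<theta> d\<close> takes time \<open>d\<close>.\<close>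

datatype instruction = Go real real | Wait real

fun duration :: "instruction \<Rightarrow> real" where
  "duration (Go \<theta> d) = d"
| "duration (Wait z) = z"

fun velocity :: "instruction \<Rightarrow> complex" where
  "velocity (Go \<theta> d) = cis \<theta>"
| "velocity (Wait z) = 0"

text \<open>A program is an infinite list of instructions; terminating amounts to waiting forever.\<close>

type_synonym program = "nat \<Rightarrow> instruction"

definition elapsed :: "program \<Rightarrow> nat \<Rightarrow> real" where
  "elapsed p n = (\<Sum>k<n. duration (p k))"

text \<open>The second conjunct excludes programs that perform infinitely many instructions in finite time.\<close>

definition valid_program :: "program \<Rightarrow> bool" where
  "valid_program p \<longleftrightarrow>
     (\<forall>n. duration (p n) \<ge> 0) \<and> filterlim (elapsed p) at_top sequentially"

definition displacement :: "program \<Rightarrow> real \<Rightarrow> complex" where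
  "displacement p s =
     (let n = (LEAST n. s \<le> elapsed p (Suc n))
      in (\<Sum>k<n. duration (p k) *\<^sub>R velocity (p k)) + (s - elapsed p n) *\<^sub>R velocity (p n))"

text \<open>An agent runs \<open>before\<close> until it senses the other agent for the first time. If this happens at
  private time \<open>u\<close>, it interrupts the current instruction and runs \<open>afterwards u\<close> from then on. Since an
  algorithm is deterministic and the only input is whether the other agent has been sensed, this
  covers every possible behaviour (in particular stopping, or carrying on with \<open>before\<close>).\<close>

record algorithm =
  before :: program
  afterwards :: "real \<Rightarrow> program"

definition valid_algorithm :: "algorithm \<Rightarrow> bool" where
  "valid_algorithm alg \<longleftrightarrow>
     valid_program (before alg) \<and> (\<forall>u\<ge>0. valid_program (afterwards alg u))"

text \<open>Displacement from the initial position at private time \<open>s\<close>, in private coordinates, of an agent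
  whose first sensing takes place at private time \<open>u\<close> (\<open>Some u\<close>) or never (\<open>None\<close>).\<close>

fun private_path :: "algorithm \<Rightarrow> real option \<Rightarrow> real \<Rightarrow> complex" where
  "private_path alg None s = displacement (before alg) s"
| "private_path alg (Some u) s =
     (if s \<le> u then displacement (before alg) s
      else displacement (before alg) u + displacement (afterwards alg u) (s - u))"

text \<open>The axes of B point in the directions \<open>\<phi>\<close> and \<open>\<phi> + \<chi> \<pi>/2\<close>.\<close>

definition from_B_frame :: "rv_instance \<Rightarrow> complex \<Rightarrow> complex" where
  "from_B_frame I z = (time_unit I * speed I) *\<^sub>R
     (Re z *\<^sub>R cis (axis_angle I) +
      Im z *\<^sub>R cis (axis_angle I + of_int (chirality I) * (pi / 2)))"

definition private_time_B :: "rv_instance \<Rightarrow> real \<Rightarrow> real" where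
  "private_time_B I s = (s - wakeup I) / time_unit I"

text \<open>Positions in the plane at time \<open>s \<ge> 0\<close> in the system of A, for a given time \<open>w\<close>, also in the
  system of A, of the agent's first sensing.\<close>

definition path_A :: "algorithm \<Rightarrow> real option \<Rightarrow> real \<Rightarrow> complex" where
  "path_A alg w s = private_path alg w s"

definition path_B :: "rv_instance \<Rightarrow> algorithm \<Rightarrow> real option \<Rightarrow> real \<Rightarrow> complex" where
  "path_B I alg w s =
     (if s < wakeup I then start_B I
      else start_B I + from_B_frame I
             (private_path alg (map_option (private_time_B I) w) (private_time_B I s)))"

text \<open>The sets to which this is applied are closed (paths are continuous) and bounded below, so the
  infimum is a minimum.\<close>

definition first_time :: "real set \<Rightarrow> real option" where
  "first_time S = (if S = {} then None else Some (Inf S))"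

text \<open>Being within distance \<open>radius\<close> is symmetric, but B senses only once awake. Hence B has sensed
  nothing as long as A has not, so the first sensing by A is determined by the paths in which
  nothing has been sensed. A may have sensed B already while B was asleep, so the first sensing by B
  is determined by the actual path of A.\<close>

definition sensing_A :: "rv_instance \<Rightarrow> algorithm \<Rightarrow> real option" where
  "sensing_A I alg =
     first_time {s. 0 \<le> s \<and> dist (path_A alg None s) (path_B I alg None s) \<le> radius I}"

definition position_A :: "rv_instance \<Rightarrow> algorithm \<Rightarrow> real \<Rightarrow> complex" where
  "position_A I alg = path_A alg (sensing_A I alg)"

definition sensing_B :: "rv_instance \<Rightarrow> algorithm \<Rightarrow> real option" where
  "sensing_B I alg =
     first_time {s. wakeup I \<le> s \<and> dist (position_A I alg s) (path_B I alg None s) \<le> radius I}"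

definition position_B :: "rv_instance \<Rightarrow> algorithm \<Rightarrow> real \<Rightarrow> complex" where
  "position_B I alg = path_B I alg (sensing_B I alg)"

definition rendezvous :: "rv_instance \<Rightarrow> algorithm \<Rightarrow> bool" where
  "rendezvous I alg \<longleftrightarrow>
     (\<exists>T\<ge>0. dist (position_A I alg T) (position_B I alg T) \<le> radius I \<and>
        (\<forall>s\<ge>T. position_A I alg s = position_A I alg T \<and>
                position_B I alg s = position_B I alg T))"

definition feasible :: "rv_instance \<Rightarrow> bool" where
  "feasible I \<longleftrightarrow> (\<exists>alg. valid_algorithm alg \<and> rendezvous I alg)"

definition canonical_line :: "rv_instance \<Rightarrow> complex set" where
  "canonical_line I =
     {midpoint 0 (start_B I) + c *\<^sub>R cis (axis_angle I / 2) | c. c \<in> (UNIV :: real set)}"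

definition orth_proj :: "complex set \<Rightarrow> complex \<Rightarrow> complex" where
  "orth_proj L z = (THE p. p \<in> L \<and> (\<forall>q\<in>L. orthogonal (z - p) (q - p)))"

definition proj_A :: "rv_instance \<Rightarrow> complex" where
  "proj_A I = orth_proj (canonical_line I) 0"

definition proj_B :: "rv_instance \<Rightarrow> complex" where
  "proj_B I = orth_proj (canonical_line I) (start_B I)"

end

theory Submission
  imports Defs
begin

text \<open>
  Stopping at the first sight is optimal: if the agents ever get within distance \<open>r\<close> while following
  their common program obliviously, stopping there is a rendezvous, and otherwise neither agent
  ever learns anything. So an instance is feasible iff some program \<open>f\<close> satisfies
  \<open>\<bar>f s - (b + M f ((s - t) / \<tau>))\<bar> \<le> r\<close> at some time \<open>s\<close>, where \<open>b\<close> is the start of B and \<open>M\<close> is the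
  similarity of ratio \<open>\<tau> v\<close> given by the frame of B.

  If \<open>1 - M\<close> is invertible, both agents go to the solution \<open>z\<close> of \<open>z - M z = b\<close> and wait. If
  \<open>\<tau> \<noteq> 1\<close>, waiting long enough desynchronises the agents, so that one of them moves to the
  other's start while the latter is still (or already) at rest. In the remaining cases \<open>M\<close> is an
  isometry that fixes a direction \<open>e\<close> (every direction if \<open>M = 1\<close>). As \<open>f\<close> is 1-Lipschitz, the
  agents can only gain the delay \<open>t\<close> along \<open>e\<close>, and this gain is achieved after the
  components orthogonal to \<open>e\<close> have been cancelled.
\<close>

section \<open>Displacements\<close>

lemma elapsed_0 [simp]: "elapsed p 0 = 0"
  and elapsed_Suc: "elapsed p (Suc n) = elapsed p n + duration (p n)"
  by (simp_all add: elapsed_def)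

lemma mono_elapsed: "valid_program p \<Longrightarrow> mono (elapsed p)"
  by (rule incseq_SucI) (simp add: elapsed_Suc valid_program_def)

lemma ex_elapsed_ge:
  assumes "valid_program p"
  shows "\<exists>n\<ge>m. s \<le> elapsed p n"
proof -
  have "eventually (\<lambda>n. s \<le> elapsed p n \<and> m \<le> n) sequentially"
    using assms by (intro eventually_conj eventually_ge_at_top)
      (auto simp: valid_program_def filterlim_at_top)
  then show ?thesis
    using eventually_happens'[OF sequentially_bot] by blast
qed

lemma norm_velocity_le_1: "norm (velocity i) \<le> 1"
  by (cases i) auto

text \<open>The truncated durations make the displacement at different times a sum over the same range.\<close>

lemma displacement_eq_truncated_sum:
  assumes p: "valid_program p" and "0 \<le> s" and N: "s \<le> elapsed p N"
  shows "displacement p s =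
    (\<Sum>k<N. (min s (elapsed p (Suc k)) - min s (elapsed p k)) *\<^sub>R velocity (p k))"
    (is "_ = (\<Sum>k<N. ?c k *\<^sub>R _)")
proof -
  note mono = monoD[OF mono_elapsed[OF p]]
  define n where "n = (LEAST n. s \<le> elapsed p (Suc n))"
  have "s \<le> elapsed p (Suc N)"
    using N mono[of N "Suc N"] by simp
  then have n: "s \<le> elapsed p (Suc n)"
    unfolding n_def by (rule LeastI)
  have below: "elapsed p (Suc k) < s" if "k < n" for k
    using not_less_Least[of k "\<lambda>n. s \<le> elapsed p (Suc n)"] that by (simp add: n_def)
  have n_le: "elapsed p n \<le> s"
    using below[of "n - 1"] \<open>0 \<le> s\<close> by (cases n) auto
  have lt: "?c k = duration (p k)" if "k < n" for k
    using below[OF that] mono[of k "Suc k"] by (simp add: elapsed_Suc)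
  have eq: "?c n = s - elapsed p n"
    using n n_le by simp
  have gt: "?c k = 0" if "n < k" for k
    using n mono[of "Suc n" k] mono[of k "Suc k"] that by simp
  have ge_N: "?c k = 0" if "N \<le> k" for k
    using N mono[of N k] mono[of k "Suc k"] that by simp
  \<comment> \<open>Terms vanish beyond either bound, so both sums equal the one up to the maximum;
    \<open>N = 0\<close> needs no special case.\<close>
  have "(\<Sum>k<N. ?c k *\<^sub>R velocity (p k)) = (\<Sum>k<max N (Suc n). ?c k *\<^sub>R velocity (p k))"
    using ge_N by (intro sum.mono_neutral_left) auto
  also have "\<dots> = (\<Sum>k<Suc n. ?c k *\<^sub>R velocity (p k))"
    using gt by (intro sum.mono_neutral_right) auto
  also have "\<dots> = (\<Sum>k<n. duration (p k) *\<^sub>R velocity (p k)) + (s - elapsed p n) *\<^sub>R velocity (p n)"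
    using lt eq by simp
  finally show ?thesis
    by (simp add: displacement_def n_def Let_def)
qed

lemma displacement_0 [simp]: "valid_program p \<Longrightarrow> displacement p 0 = 0"
  using displacement_eq_truncated_sum[of p 0 0] by simp

lemma displacement_lipschitz:
  assumes p: "valid_program p" and "0 \<le> s" "s \<le> s'"
  shows "norm (displacement p s' - displacement p s) \<le> s' - s"
proof -
  note mono = monoD[OF mono_elapsed[OF p]]
  obtain N where N: "s' \<le> elapsed p N"
    using ex_elapsed_ge[OF p] by blast
  \<comment> \<open>How much of the time from \<open>s\<close> to \<open>s'\<close> lies before the
    start of instruction \<open>k\<close>; the increments are nonnegative and telescope.\<close>
  let ?h = "\<lambda>k. min s' (elapsed p k) - min s (elapsed p k)"
  have "displacement p s' - displacement p s = (\<Sum>k<N. (?h (Suc k) - ?h k) *\<^sub>R velocity (p k))"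
    using assms N
    by (subst (1 2) displacement_eq_truncated_sum[where N = N])
      (simp_all add: algebra_simps flip: sum_subtractf)
  also have "norm \<dots> \<le> (\<Sum>k<N. ?h (Suc k) - ?h k)"
  proof (rule sum_norm_le)
    fix k
    have "0 \<le> ?h (Suc k) - ?h k"
      using mono[of k "Suc k"] \<open>s \<le> s'\<close> by (auto simp: min_def)
    then show "norm ((?h (Suc k) - ?h k) *\<^sub>R velocity (p k)) \<le> ?h (Suc k) - ?h k"
      using mult_left_mono[OF norm_velocity_le_1, of "?h (Suc k) - ?h k" "p k"] by simp
  qed
  also have "\<dots> = s' - s"
    using assms N by (subst sum_lessThan_telescope[of ?h]) simp
  finally show ?thesis .
qed

lemma continuous_on_displacement:
  assumes "valid_program p"
  shows "continuous_on {0..} (displacement p)"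
proof -
  have "1-lipschitz_on {0..} (displacement p)"
  proof (rule lipschitz_onI)
    fix s s' :: real
    assume "s \<in> {0..}" "s' \<in> {0..}"
    then show "dist (displacement p s) (displacement p s') \<le> 1 * dist s s'"
      using displacement_lipschitz[OF assms, of s s'] displacement_lipschitz[OF assms, of s' s]
      by (cases "s \<le> s'") (auto simp: dist_norm norm_minus_commute)
  qed simp
  then show ?thesis
    by (rule lipschitz_on_continuous_on)
qed

section \<open>Feasibility in terms of oblivious motion\<close>

lemma linear_from_B_frame: "linear (from_B_frame I)"
  by (rule linearI) (simp_all add: from_B_frame_def algebra_simps)

lemma from_B_frame_0 [simp]: "from_B_frame I 0 = 0"
  by (simp add: from_B_frame_def)

text \<open>Holding the private clock at 0 during sleep replaces a case distinction and makes
  continuity at the wake-up evident.\<close>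

definition oblivious_B :: "rv_instance \<Rightarrow> program \<Rightarrow> real \<Rightarrow> complex" where
  "oblivious_B I p s = start_B I +
     from_B_frame I (displacement p (max 0 ((s - wakeup I) / time_unit I)))"

lemma path_B_None:
  assumes "valid_instance I" "valid_program (before alg)"
  shows "path_B I alg None s = oblivious_B I (before alg) s"
proof (cases "s < wakeup I")
  case True
  then have "(s - wakeup I) / time_unit I \<le> 0"
    using assms by (simp add: valid_instance_def divide_nonpos_pos)
  with True assms show ?thesis
    by (simp add: path_B_def oblivious_B_def max_absorb1)
next
  case False
  then have "(s - wakeup I) / time_unit I \<ge> 0"
    using assms by (simp add: valid_instance_def)
  with False show ?thesis
    by (simp add: path_B_def oblivious_B_def private_time_B_def max_absorb2)
qed

lemma oblivious_B_asleep:
  assumes "valid_instance I" "valid_program p" "s \<le> wakeup I"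
  shows "oblivious_B I p s = start_B I"
proof -
  have "(s - wakeup I) / time_unit I \<le> 0"
    using assms by (simp add: valid_instance_def divide_nonpos_pos)
  with assms show ?thesis
    by (simp add: oblivious_B_def max_absorb1)
qed

lemma continuous_on_oblivious_B:
  assumes "valid_instance I" "valid_program p"
  shows "continuous_on A (oblivious_B I p)"
proof -
  have "continuous_on A (\<lambda>s. displacement p (max 0 ((s - wakeup I) / time_unit I)))"
    using assms(1)
    by (intro continuous_on_compose2[OF continuous_on_displacement[OF assms(2)]]
        continuous_intros) (auto simp: valid_instance_def)
  then show ?thesis
    unfolding oblivious_B_def
    by (intro continuous_intros linear_continuous_on_compose[OF _ linear_from_B_frame])
qed

definition meeting_times :: "rv_instance \<Rightarrow> program \<Rightarrow> real set" where
  "meeting_times I p = {s. 0 \<le> s \<and> dist (displacement p s) (oblivious_B I p s) \<le> radius I}"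

lemma Inf_meeting_times:
  assumes "valid_instance I" "valid_program p" "meeting_times I p \<noteq> {}"
  shows "Inf (meeting_times I p) \<in> meeting_times I p"
proof -
  have "closed {s \<in> {0..}. dist (displacement p s) (oblivious_B I p s) \<le> radius I}"
    using assms by (intro 
      continuous_on_closed_Collect_le continuous_intros continuous_on_displacement
      continuous_on_oblivious_B) auto
  moreover have "{s \<in> {0..}. dist (displacement p s) (oblivious_B I p s) \<le> radius I}
      = meeting_times I p"
    by (auto simp: meeting_times_def)
  ultimately show ?thesis
    using assms(3) by (intro closed_contains_Inf) (auto simp: meeting_times_def intro!: bdd_belowI[of _ 0])
qed

definition idle :: program where
  "idle = (\<lambda>_. Wait 1)"

lemma valid_program_idle: "valid_program idle"
proof -
  have "elapsed idle = real"
    by (simp add: elapsed_def idle_def fun_eq_iff)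
  then show ?thesis
    by (simp add: valid_program_def filterlim_real_sequentially) (simp add: idle_def)
qed

lemma displacement_idle [simp]: "displacement idle s = 0"
  by (simp add: displacement_def idle_def)

lemma sensing_A_eq:
  assumes "valid_instance I" "valid_program (before alg)"
  shows "sensing_A I alg = first_time (meeting_times I (before alg))"
  using assms by (simp add: sensing_A_def meeting_times_def path_A_def path_B_None)

lemma feasible_if_meeting:
  assumes I: "valid_instance I" and p: "valid_program p" and ne: "meeting_times I p \<noteq> {}"
  shows "feasible I"
proof -
  define alg where "alg = \<lparr>before = p, afterwards = \<lambda>_. idle\<rparr>"
  define s0 where "s0 = Inf (meeting_times I p)"
  \<comment> \<open>The moment when B senses: if A stops near the sleeping B, B notices only on
    waking.\<close>
  define s1 where "s1 = max s0 (wakeup I)"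
  have [simp]: "before alg = p" "\<And>u. afterwards alg u = idle"
    by (simp_all add: alg_def)
  have \<tau>: "time_unit I > 0"
    using I by (simp add: valid_instance_def)
  have s0: "0 \<le> s0" "dist (displacement p s0) (oblivious_B I p s0) \<le> radius I"
    using Inf_meeting_times[OF assms] by (simp_all add: s0_def meeting_times_def)
  have s0_le: "s0 \<le> s" if "s \<in> meeting_times I p" for s
    unfolding s0_def using that
    by (rule cInf_lower) (auto simp: meeting_times_def intro!: bdd_belowI[of _ 0])
  have posA: "position_A I alg s = displacement p (min s s0)" for s
    using I p ne by (simp add: position_A_def path_A_def sensing_A_eq first_time_def s0_def min_def)
  have B1: "oblivious_B I p s1 = oblivious_B I p s0"
    using oblivious_B_asleep[OF I p] by (simp add: s1_def max_def)
  have "Inf {s. wakeup I \<le> s \<and> dist (position_A I alg s) (path_B I alg None s) \<le> radius I} = s1"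
  proof (rule cInf_eq_minimum)
    show "s1 \<in> {s. wakeup I \<le> s \<and> dist (position_A I alg s) (path_B I alg None s) \<le> radius I}"
      using I p s0 B1 by (simp add: posA path_B_None s1_def)
  next
    fix s
    assume "s \<in> {s. wakeup I \<le> s \<and> dist (position_A I alg s) (path_B I alg None s) \<le> radius I}"
    then have s: "wakeup I \<le> s" "dist (displacement p (min s s0)) (oblivious_B I p s) \<le> radius I"
      using I p by (simp_all add: posA path_B_None)
    moreover have "0 \<le> s"
      using I s(1) by (simp add: valid_instance_def)
    \<comment> \<open>Before \<open>s0\<close> A has not stopped yet, so an earlier sensing by B
      would be an oblivious meeting before the first one.\<close>
    ultimately have "s0 \<le> s"
      using s0_le[of s] by (cases "s \<le> s0") (auto simp: meeting_times_def min_def)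
    with s show "s1 \<le> s"
      by (simp add: s1_def)
  qed
  moreover have "s1 \<in> {s. wakeup I \<le> s \<and> dist (position_A I alg s) (path_B I alg None s) \<le> radius I}"
    using I p s0 B1 by (simp add: posA path_B_None s1_def)
  ultimately have sensB: "sensing_B I alg = Some s1"
    by (auto simp: sensing_B_def first_time_def)
  have posB: "position_B I alg s = oblivious_B I p s1" if "s1 \<le> s" for s
  proof -
    have "private_time_B I s1 \<le> private_time_B I s" "0 \<le> private_time_B I s1"
      "\<not> s < wakeup I"
      using that \<tau> by (auto simp: private_time_B_def s1_def divide_right_mono)
    then show ?thesis
      by (auto simp: position_B_def sensB path_B_def oblivious_B_def private_time_B_def)
  qed
  have "rendezvous I alg"
    unfolding rendezvous_def
  proof (intro exI[of _ s1] conjI allI impI)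
    show "0 \<le> s1"
      using s0 by (simp add: s1_def)
    show "dist (position_A I alg s1) (position_B I alg s1) \<le> radius I"
      using s0 B1 by (simp add: posA posB) (simp add: s1_def)
  next
    fix s
    assume "s1 \<le> s"
    then show "position_A I alg s = position_A I alg s1" "position_B I alg s = position_B I alg s1"
      by (simp_all add: posA posB) (simp add: s1_def min_absorb2)
  qed
  moreover have "valid_algorithm alg"
    using p by (simp add: valid_algorithm_def valid_program_idle)
  ultimately show ?thesis
    by (auto simp: feasible_def)
qed

text \<open>Without an oblivious meeting nobody ever senses anything, so the actual paths are the
  oblivious ones and the rendezvous itself would be such a meeting.\<close>

lemma meeting_if_feasible:
  assumes I: "valid_instance I" and "feasible I"
  obtains p s where "valid_program p" "s \<in> meeting_times I p"
proof -
  obtain alg where alg: "valid_algorithm alg" "rendezvous I alg"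
    using assms by (auto simp: feasible_def)
  have p: "valid_program (before alg)"
    using alg by (simp add: valid_algorithm_def)
  have "meeting_times I (before alg) \<noteq> {}"
  proof
    assume empty: "meeting_times I (before alg) = {}"
    then have posA: "position_A I alg = displacement (before alg)"
      using I p by (simp add: position_A_def path_A_def sensing_A_eq first_time_def fun_eq_iff)
    have "{s. wakeup I \<le> s \<and> dist (position_A I alg s) (path_B I alg None s) \<le> radius I}
        \<subseteq> meeting_times I (before alg)"
      using I p by (auto simp: posA path_B_None meeting_times_def valid_instance_def)
    then have "sensing_B I alg = None"
      using empty by (simp add: sensing_B_def first_time_def)
    then have "position_B I alg = oblivious_B I (before alg)"
      using I p by (simp add: position_B_def path_B_None fun_eq_iff)
    with alg(2) posA empty show False
      by (auto simp: rendezvous_def meeting_times_def)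
  qed
  with p that show ?thesis
    by blast
qed

section \<open>A program with two moves\<close>

text \<open>This shape suffices for every feasible instance. A zero vector gives a move of length 0,
  so the value of \<open>Arg 0\<close> is irrelevant.\<close>

definition two_moves :: "complex \<Rightarrow> real \<Rightarrow> complex \<Rightarrow> program" where
  "two_moves z W z' n =
     (if n = 0 then Go (Arg z) (norm z) else if n = 1 then Wait W
      else if n = 2 then Go (Arg z') (norm z') else Wait 1)"

lemma elapsed_two_moves:
  "elapsed (two_moves z W z') (n + 3) = norm z + W + norm z' + real n"
  by (induction n) (simp_all add: elapsed_Suc two_moves_def eval_nat_numeral)

lemma valid_two_moves:
  assumes "0 \<le> W"
  shows "valid_program (two_moves z W z')"
proof -
  have "filterlim (\<lambda>n. norm z + W + norm z' + real n) at_top sequentially"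
    by (intro filterlim_tendsto_add_at_top[OF tendsto_const] filterlim_real_sequentially)
  then have "filterlim (\<lambda>n. elapsed (two_moves z W z') (n + 3)) at_top sequentially"
    by (simp only: elapsed_two_moves)
  then have "eventually (\<lambda>n. Z \<le> elapsed (two_moves z W z') (n + 3)) sequentially" for Z
    unfolding filterlim_at_top by blast
  then have "filterlim (elapsed (two_moves z W z')) at_top sequentially"
    unfolding filterlim_at_top by (blast intro: eventually_sequentially_seg[THEN iffD1])
  with assms show ?thesis
    by (simp add: valid_program_def two_moves_def)
qed

lemma displacement_two_moves:
  assumes W: "0 \<le> W" and s: "0 \<le> s"
  shows "displacement (two_moves z W z') s = min s (norm z) *\<^sub>R cis (Arg z) +
    (min s (norm z + W + norm z') - min s (norm z + W)) *\<^sub>R cis (Arg z')"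
proof -
  let ?p = "two_moves z W z'"
  let ?f = "\<lambda>k. (min s (elapsed ?p (Suc k)) - min s (elapsed ?p k)) *\<^sub>R velocity (?p k)"
  note p = valid_two_moves[OF W, of z z']
  obtain N where N: "3 \<le> N" "s \<le> elapsed ?p N"
    using ex_elapsed_ge[OF p] by blast
  have "displacement ?p s = (\<Sum>k<N. ?f k)"
    by (rule displacement_eq_truncated_sum[OF p s N(2)])
  also have "\<dots> = (\<Sum>k<3. ?f k)"
    using N(1) by (intro sum.mono_neutral_right) (auto simp: two_moves_def)
  finally show ?thesis
    using s by (simp add: eval_nat_numeral elapsed_Suc two_moves_def)
qed

lemma norm_scaleR_cis_Arg: "norm z *\<^sub>R cis (Arg z) = z"
  using rcis_cmod_Arg[of z] by (simp add: rcis_def scaleR_conv_of_real)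

lemma displacement_two_moves_mid:
  assumes "0 \<le> W" "norm z \<le> s" "s \<le> norm z + W"
  shows "displacement (two_moves z W z') s = z"
proof -
  have "0 \<le> s" "s \<le> norm z + W + norm z'"
    using assms norm_ge_zero[of z] norm_ge_zero[of z'] by linarith+
  then show ?thesis
    using assms by (simp add: displacement_two_moves min_absorb1 min_absorb2 norm_scaleR_cis_Arg)
qed

lemma displacement_two_moves_end:
  assumes "0 \<le> W" "norm z + W + norm z' \<le> s"
  shows "displacement (two_moves z W z') s = z + z'"
proof -
  have "0 \<le> s" "norm z \<le> s" "norm z + W \<le> s"
    using assms norm_ge_zero[of z] norm_ge_zero[of z'] by linarith+
  then show ?thesis
    using assms by (simp add: displacement_two_moves min_absorb2 norm_scaleR_cis_Arg)
qed

section \<open>The frame of B\<close>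

lemma from_B_frame_pos:
  "chirality I = 1 \<Longrightarrow>
     from_B_frame I z = (time_unit I * speed I) *\<^sub>R (cis (axis_angle I) * z)"
  by (simp add: from_B_frame_def complex_eq_iff cos_add sin_add algebra_simps)

lemma from_B_frame_neg:
  "chirality I = -1 \<Longrightarrow>
     from_B_frame I z = (time_unit I * speed I) *\<^sub>R (cis (axis_angle I) * cnj z)"
  by (simp add: from_B_frame_def complex_eq_iff cos_diff sin_diff algebra_simps)

lemma cis_neq_1: "0 < x \<Longrightarrow> x < 2 * pi \<Longrightarrow> cis x \<noteq> 1"
proof
  assume x: "0 < x" "x < 2 * pi" and "cis x = 1"
  then have "cos x = 1"
    by (simp add: complex_eq_iff)
  then obtain n :: int where n: "x = of_int n * (2 * pi)"
    by (auto simp: cos_one_2pi_int)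
  with x have "0 < n" "n < 1"
    by (simp_all add: zero_less_mult_iff)
  then show False
    by simp
qed

text \<open>The equation and its conjugate form a linear system in \<open>z\<close> and
  \<open>cnj z\<close> with determinant \<open>1 - c * cnj c\<close>; the witness is Cramer's
  rule.\<close>

lemma minus_cnj_surj:
  fixes c b :: complex
  assumes "norm c \<noteq> 1"
  shows "\<exists>z. z - c * cnj z = b"
proof -
  have ne: "1 - c * cnj c \<noteq> 0"
  proof
    assume "1 - c * cnj c = 0"
    then have "of_real ((norm c)\<^sup>2) = (1 :: complex)"
      using complex_norm_square[of c] by simp
    with assms show False
      by (simp only: of_real_eq_1_iff power2_eq_1_iff) (use norm_ge_zero[of c] in linarith)
  qed
  define z where "z = (b + c * cnj b) / (1 - c * cnj c)"
  have "cnj z = (cnj b + cnj c * b) / (1 - c * cnj c)"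
    by (simp add: z_def mult.commute)
  then have "z - c * cnj z = (b * (1 - c * cnj c)) / (1 - c * cnj c)"
    by (simp add: z_def algebra_simps flip: diff_divide_distrib add_divide_distrib)
  with ne show ?thesis
    by auto
qed

text \<open>A similarity of ratio other than 1, or a nontrivial rotation, fixes no nonzero vector.
  The solution is a target with the same private coordinates for both agents.\<close>

lemma minus_from_B_frame_surj:
  assumes I: "valid_instance I"
    and ne: "time_unit I * speed I \<noteq> 1 \<or> chirality I = 1 \<and> axis_angle I \<noteq> 0"
  shows "\<exists>z. z - from_B_frame I z = b"
proof -
  define c where "c = (time_unit I * speed I) *\<^sub>R cis (axis_angle I)"
  have norm_c: "norm c = time_unit I * speed I"
    using I by (simp add: c_def valid_instance_def)
  show ?thesis
  proof (cases "chirality I = 1")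
    case True
    have "c \<noteq> 1"
    proof
      assume "c = 1"
      with norm_c have "time_unit I * speed I = 1"
        by simp
      with \<open>c = 1\<close> ne have "cis (axis_angle I) = 1" "axis_angle I \<noteq> 0"
        by (simp_all add: c_def)
      then show False
        using cis_neq_1[of "axis_angle I"] I by (simp add: valid_instance_def)
    qed
    then show ?thesis
      by (intro exI[of _ "b / (1 - c)"]) (simp add: from_B_frame_pos[OF True] c_def field_simps)
  next
    case False
    then have neg: "chirality I = -1"
      using I by (auto simp: valid_instance_def)
    then show ?thesis
      using minus_cnj_surj[of c b] norm_c ne by (auto simp: from_B_frame_neg[OF neg] c_def)
  qed
qed

lemma from_B_frame_isometry_surj:
  assumes I: "valid_instance I" and "time_unit I * speed I = 1"
  shows "\<exists>z. from_B_frame I z = b"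
proof (cases "chirality I = 1")
  case True
  with assms show ?thesis
    by (intro exI[of _ "cis (- axis_angle I) * b"])
      (simp add: from_B_frame_pos cis_mult flip: mult.assoc)
next
  case False
  then have "chirality I = -1"
    using I by (auto simp: valid_instance_def)
  with assms show ?thesis
    by (intro exI[of _ "cis (axis_angle I) * cnj b"])
      (simp add: from_B_frame_neg cis_mult cis_cnj flip: mult.assoc)
qed

lemma from_B_frame_sync_neg:
  assumes "synchronous I" "chirality I = -1"
  shows "from_B_frame I z = cis (axis_angle I / 2) * cis (axis_angle I / 2) * cnj z"
  using assms by (simp add: from_B_frame_neg synchronous_def cis_mult)

lemma inner_eq_Re_cnj: "inner x y = Re (cnj x * y)" for x y :: complex
  by (simp add: inner_complex_def)

text \<open>In coordinates rotated by the half angle the frame map is complex conjugation, which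
  keeps real parts.\<close>

lemma inner_from_B_frame_sync:
  assumes "synchronous I" "chirality I = -1"
  shows "inner (cis (axis_angle I / 2)) (from_B_frame I z) = inner (cis (axis_angle I / 2)) z"
proof -
  let ?e = "cis (axis_angle I / 2)"
  have "cnj ?e * from_B_frame I z = ?e * cnj z"
    using assms by (simp add: from_B_frame_sync_neg cis_cnj cis_mult flip: mult.assoc)
  then show ?thesis
    by (simp add: inner_eq_Re_cnj)
qed

text \<open>In the same rotated coordinates \<open>z\<close> is purely imaginary, so conjugation
  negates it.\<close>

lemma from_B_frame_orthogonal_sync:
  assumes "synchronous I" "chirality I = -1" "inner (cis (axis_angle I / 2)) z = 0"
  shows "from_B_frame I z = - z"
proof -
  let ?e = "cis (axis_angle I / 2)"
  have "Re (cnj ?e * z) = 0"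
    using assms by (simp add: inner_eq_Re_cnj)
  then have "cnj (cnj ?e * z) = - (cnj ?e * z)"
    by (simp only: complex_eq_iff) simp
  then have "from_B_frame I z = ?e * - (cnj ?e * z)"
    using assms by (simp add: from_B_frame_sync_neg mult.assoc)
  also have "\<dots> = - z"
    by (simp add: cis_cnj cis_mult flip: mult.assoc)
  finally show ?thesis .
qed

section \<open>The canonical line\<close>

lemma orth_proj_eqI:
  assumes p: "p \<in> L" "\<And>q. q \<in> L \<Longrightarrow> inner (z - p) (q - p) = 0"
  shows "orth_proj L z = p"
  unfolding orth_proj_def
proof (rule the_equality)
  show "p \<in> L \<and> (\<forall>q\<in>L. orthogonal (z - p) (q - p))"
    using p by (simp add: orthogonal_def)
next
  fix p'
  assume p': "p' \<in> L \<and> (\<forall>q\<in>L. orthogonal (z - p') (q - p'))"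
  then have "inner (z - p) (p' - p) = 0" "inner (z - p') (p - p') = 0"
    using p by (auto simp: orthogonal_def)
  \<comment> \<open>Each candidate was tested against the other; the sum of the two equations is the
    squared distance.\<close>
  then have "inner (p' - p) (p' - p) = 0"
    by (simp add: inner_diff_left inner_diff_right inner_commute)
  then show "p' = p"
    by simp
qed

lemma orth_proj_line:
  assumes "norm e = 1"
  shows "orth_proj {m + c *\<^sub>R e | c. c \<in> (UNIV :: real set)} z = m + inner e (z - m) *\<^sub>R e"
proof (rule orth_proj_eqI)
  have e: "inner e e = 1"
    using assms by (simp add: dot_square_norm)
  fix q
  assume "q \<in> {m + c *\<^sub>R e | c. c \<in> (UNIV :: real set)}"
  then obtain c where "q = m + c *\<^sub>R e"
    by blast
  then have "q - (m + inner e (z - m) *\<^sub>R e) = (c - inner e (z - m)) *\<^sub>R e"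
    by (simp add: algebra_simps)
  moreover have "inner (z - (m + inner e (z - m) *\<^sub>R e)) e = 0"
    using e by (simp add: inner_diff_left inner_diff_right inner_add_left inner_commute algebra_simps)
  ultimately show "inner (z - (m + inner e (z - m) *\<^sub>R e)) (q - (m + inner e (z - m) *\<^sub>R e)) = 0"
    by simp
qed blast

lemma dist_proj:
  "dist (proj_A I) (proj_B I) = \<bar>inner (cis (axis_angle I / 2)) (start_B I)\<bar>"
proof -
  let ?e = "cis (axis_angle I / 2)"
  have "proj_B I - proj_A I = inner ?e (start_B I) *\<^sub>R ?e"
    unfolding proj_A_def proj_B_def canonical_line_def orth_proj_line[OF norm_cis]
    by (simp add: inner_diff_right algebra_simps)
  then show ?thesis
    by (simp add: dist_norm norm_minus_commute[of "proj_A I"])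
qed

section \<open>The characterisation\<close>

lemma feasible_two_moves:
  assumes "valid_instance I" "0 \<le> W" "0 \<le> s"
    and "dist (displacement (two_moves z W z') s) (oblivious_B I (two_moves z W z') s) \<le> radius I"
  shows "feasible I"
  using assms by (intro feasible_if_meeting[OF _ valid_two_moves]) (auto simp: meeting_times_def)

section \<open>Meetings that exist whatever the wake-up time\<close>

lemma feasible_if_fixed_point:
  assumes I: "valid_instance I" and z: "z - from_B_frame I z = start_B I"
  shows "feasible I"
proof -
  \<comment> \<open>Late enough for both agents to have reached the common target.\<close>
  define s where "s = norm z + wakeup I + time_unit I * norm z"
  have pos: "time_unit I > 0" "wakeup I \<ge> 0" "radius I > 0"
    using I by (auto simp: valid_instance_def)
  then have s: "norm z \<le> s" "norm z \<le> (s - wakeup I) / time_unit I"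
    by (simp_all add: s_def field_simps)
  then have "displacement (two_moves 0 0 z) s = z"
    "displacement (two_moves 0 0 z) (max 0 ((s - wakeup I) / time_unit I)) = z"
    by (auto simp: displacement_two_moves_end)
  moreover have "z = start_B I + from_B_frame I z"
    using z by (simp add: algebra_simps)
  moreover have "0 \<le> s"
    using s(1) norm_ge_zero[of z] by linarith
  ultimately show ?thesis
    using I pos by (intro feasible_two_moves[of I 0 s 0 z]) (simp_all add: oblivious_B_def)
qed

lemma feasible_if_slow_clock:
  assumes I: "valid_instance I" and \<tau>: "1 < time_unit I"
  shows "feasible I"
proof -
  define b where "b = start_B I"
  \<comment> \<open>Solves \<open>W * time_unit I = W + norm b\<close>: A reaches the start of B no
    later than the end of B's wait, even if B wakes at time 0.\<close>
  define W where "W = norm b / (time_unit I - 1)"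
  define s where "s = W + norm b"
  have pos: "wakeup I \<ge> 0" "radius I > 0" "0 \<le> W"
    using I \<tau> by (auto simp: valid_instance_def W_def)
  have "W * time_unit I = s"
    using \<tau> by (simp add: W_def s_def field_simps)
  then have "max 0 ((s - wakeup I) / time_unit I) \<le> W"
    using \<tau> pos by (simp add: divide_le_eq)
  then have "displacement (two_moves 0 W b) (max 0 ((s - wakeup I) / time_unit I)) = 0"
    using pos by (intro displacement_two_moves_mid) auto
  moreover have "displacement (two_moves 0 W b) s = b"
    using pos by (simp add: displacement_two_moves_end s_def)
  ultimately show ?thesis
    using I pos by (intro feasible_two_moves[of I W s 0 b]) (simp_all add: oblivious_B_def b_def s_def)
qed

lemma feasible_if_fast_clock:
  assumes I: "valid_instance I" and \<tau>: "time_unit I < 1" and z: "from_B_frame I z = - start_B I"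
  shows "feasible I"
proof -
  \<comment> \<open>Solves \<open>wakeup I + time_unit I * (W + norm z) = W\<close>: B arrives at
    the start of A exactly when A's wait ends.\<close>
  define W where "W = (wakeup I + time_unit I * norm z) / (1 - time_unit I)"
  have pos: "wakeup I \<ge> 0" "radius I > 0" "time_unit I > 0"
    using I by (auto simp: valid_instance_def)
  then have W: "0 \<le> W"
    using \<tau> by (simp add: W_def)
  have "(W - wakeup I) / time_unit I = W + norm z"
    using \<tau> pos by (simp add: W_def field_simps)
  then have "displacement (two_moves 0 W z) (max 0 ((W - wakeup I) / time_unit I)) = z"
    using W by (subst displacement_two_moves_end) auto
  moreover have "displacement (two_moves 0 W z) W = 0"
    using W by (intro displacement_two_moves_mid) auto
  ultimately show ?thesis
    using I pos W z by (intro feasible_two_moves[of I W W 0 z]) (simp_all add: oblivious_B_def)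
qed

text \<open>If the length units agree, the clocks must differ; otherwise the frame map is no
  isometry and a common target exists.\<close>

lemma feasible_if_not_synchronous:
  assumes I: "valid_instance I" and "\<not> synchronous I"
  shows "feasible I"
proof (cases "time_unit I * speed I = 1")
  case True
  then have "time_unit I \<noteq> 1"
    using assms by (auto simp: synchronous_def)
  then show ?thesis
    using feasible_if_slow_clock[OF I] feasible_if_fast_clock[OF I]
      from_B_frame_isometry_surj[OF I True] by (meson linorder_neqE_linordered_idom)
next
  case False
  then show ?thesis
    using minus_from_B_frame_surj[OF I] feasible_if_fixed_point[OF I] by blast
qed

section \<open>Synchronous instances whose frame map fixes a direction\<close>

text \<open>Along \<open>e\<close> both agents perform the same motion, B lagging by at most
  \<open>wakeup I\<close>; this lag and the radius must cover the initial gap.\<close>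

lemma synchronous_meeting_bound:
  assumes I: "valid_instance I" and sync: "synchronous I" and "feasible I"
    and e: "norm e \<le> 1" "\<And>z. inner e (from_B_frame I z) = inner e z"
  shows "inner e (start_B I) \<le> wakeup I + radius I"
proof -
  obtain p s where p: "valid_program p" and s: "s \<in> meeting_times I p"
    using meeting_if_feasible[OF I \<open>feasible I\<close>] .
  \<comment> \<open>B's private clock at time \<open>s\<close>, held at 0 during sleep.\<close>
  define s' where "s' = max 0 (s - wakeup I)"
  have inner_le: "- norm x \<le> inner e x" "inner e x \<le> norm x" for x
    using Cauchy_Schwarz_ineq2[of e x] mult_right_mono[OF e(1) norm_ge_zero[of x]] by auto
  have "s' \<le> s" "0 \<le> s'" "s - s' \<le> wakeup I"
    using s I by (auto simp: s'_def meeting_times_def valid_instance_def)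
  then have "norm (displacement p s - displacement p s') \<le> wakeup I"
    using displacement_lipschitz[OF p, of s' s] by simp
  moreover have "norm (displacement p s - (start_B I + from_B_frame I (displacement p s'))) \<le> radius I"
    using s sync by (simp add: meeting_times_def oblivious_B_def s'_def synchronous_def dist_norm)
  ultimately show ?thesis
    using inner_le(2)[of "displacement p s - displacement p s'"]
      inner_le(1)[of "displacement p s - (start_B I + from_B_frame I (displacement p s'))"]
    by (simp add: inner_diff_right inner_add_right e(2))
qed

text \<open>The first move cancels the component \<open>b - (e \<bullet> b) e\<close>, of which each agent covers one half
  since \<open>M\<close> negates it. B ends this move a delay \<open>t\<close> after A, which A uses up by waiting.\<close>

lemma feasible_if_delay_ge:
  assumes I: "valid_instance I" and sync: "synchronous I" and e: "norm e = 1"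
    and z: "start_B I = inner e (start_B I) *\<^sub>R e + 2 *\<^sub>R z" "from_B_frame I z = - z"
    and t: "\<bar>inner e (start_B I)\<bar> - radius I \<le> wakeup I"
  shows "feasible I"
proof -
  define a where "a = inner e (start_B I)"
  \<comment> \<open>Just enough to shrink the gap \<open>\<bar>a\<bar>\<close> to the
    radius.\<close>
  define d where "d = max 0 (\<bar>a\<bar> - radius I)"
  define z' where "z' = (sgn a * d) *\<^sub>R e"
  define s where "s = norm z + wakeup I + norm z'"
  let ?p = "two_moves z (wakeup I) z'"
  have pos: "wakeup I \<ge> 0" "radius I > 0"
    using I by (auto simp: valid_instance_def)
  have "0 \<le> d" "d \<le> wakeup I"
    using t pos by (auto simp: d_def a_def)
  moreover have "norm z' \<le> d"
    using e \<open>0 \<le> d\<close> by (simp add: z'_def abs_mult abs_sgn_eq)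
  ultimately have z'_le: "norm z' \<le> wakeup I"
    by simp
  have "displacement ?p s = z + z'"
    using pos by (intro displacement_two_moves_end) (simp_all add: s_def)
  \<comment> \<open>The second move is no longer than the wait, so B is still waiting when A
    completes it.\<close>
  moreover have "displacement ?p (max 0 (s - wakeup I)) = z"
    using pos z'_le by (intro displacement_two_moves_mid) (auto simp: s_def)
  ultimately have "displacement ?p s - oblivious_B I ?p s = z + z' - (start_B I - z)"
    using sync z(2) by (simp add: oblivious_B_def synchronous_def)
  also have "\<dots> = (sgn a * d - a) *\<^sub>R e"
    by (subst z(1)) (simp add: z'_def a_def scaleR_2 algebra_simps)
  finally have "dist (displacement ?p s) (oblivious_B I ?p s) = \<bar>sgn a * d - a\<bar>"
    using e by (simp add: dist_norm)
  also have "\<dots> \<le> radius I"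
    using pos by (auto simp: d_def sgn_if)
  finally show ?thesis
    using I pos by (intro feasible_two_moves[of I "wakeup I" s z z']) (auto simp: s_def)
qed

lemma feasible_translation_iff:
  assumes I: "valid_instance I" and sync: "synchronous I"
    and "chirality I = 1" "axis_angle I = 0"
  shows "feasible I \<longleftrightarrow> dist 0 (start_B I) - radius I \<le> wakeup I"
proof -
  \<comment> \<open>The frame map is the identity and fixes every direction; the one towards B gives
    the sharpest bound and leaves no orthogonal component.\<close>
  define e where "e = sgn (start_B I)"
  have M: "from_B_frame I z = z" for z
    using assms by (simp add: from_B_frame_pos synchronous_def)
  have "start_B I \<noteq> 0"
    using I by (auto simp: start_B_def valid_instance_def complex_eq_iff)
  then have e: "norm e = 1" "inner e (start_B I) = norm (start_B I)"
    by (simp_all add: e_def norm_sgn sgn_div_norm dot_square_norm power2_eq_square)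
  moreover have "start_B I = norm (start_B I) *\<^sub>R e"
    using \<open>start_B I \<noteq> 0\<close> by (simp add: e_def sgn_div_norm)
  ultimately show ?thesis
    using synchronous_meeting_bound[OF I sync, of e] feasible_if_delay_ge[OF I sync, of e 0]
    by (auto simp: M)
qed

lemma feasible_reflection_iff:
  assumes I: "valid_instance I" and sync: "synchronous I" and \<chi>: "chirality I = -1"
  shows "feasible I \<longleftrightarrow> dist (proj_A I) (proj_B I) - radius I \<le> wakeup I"
proof -
  define e where "e = cis (axis_angle I / 2)"
  define z where "z = (start_B I - inner e (start_B I) *\<^sub>R e) /\<^sub>R 2"
  have e: "norm e = 1" "inner e e = 1"
    by (simp_all add: e_def dot_square_norm)
  have M: "inner e (from_B_frame I x) = inner e x" for x
    using inner_from_B_frame_sync[OF sync \<chi>] by (simp add: e_def)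
  have "inner e z = 0"
    using e by (simp add: z_def inner_diff_right)
  then have "from_B_frame I z = - z"
    using from_B_frame_orthogonal_sync[OF sync \<chi>] by (simp add: e_def)
  moreover have "start_B I = inner e (start_B I) *\<^sub>R e + 2 *\<^sub>R z"
    by (simp add: z_def)
  \<comment> \<open>The bound for \<open>e\<close> and for \<open>- e\<close> together controls the
    absolute value, which is the distance of the projections.\<close>
  ultimately show ?thesis
    using synchronous_meeting_bound[OF I sync, of e] synchronous_meeting_bound[OF I sync, of "- e"]
      feasible_if_delay_ge[OF I sync, of e z] e(1) M
    unfolding dist_proj e_def[symmetric] by (auto simp: abs_le_iff)
qed

theorem theorem3p1:
  fixes I :: rv_instance
  assumes "valid_instance I"
  shows "(\<not> synchronous I \<longrightarrow> feasible I) \<and>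
    (synchronous I \<longrightarrow>
      (feasible I \<longleftrightarrow>
         (chirality I = 1 \<and> axis_angle I \<noteq> 0) \<or>
         (chirality I = 1 \<and> axis_angle I = 0 \<and> wakeup I \<ge> dist 0 (start_B I) - radius I) \<or>
         (chirality I = -1 \<and> wakeup I \<ge> dist (proj_A I) (proj_B I) - radius I)))"
proof -
  have "feasible I" if "chirality I = 1" "axis_angle I \<noteq> 0"
    using minus_from_B_frame_surj[OF assms] feasible_if_fixed_point[OF assms] that by blast
  moreover have "chirality I = 1 \<or> chirality I = -1"
    using assms by (auto simp: valid_instance_def)
  ultimately show ?thesis
    using feasible_if_not_synchronous[OF assms] feasible_translation_iff[OF assms]
      feasible_reflection_iff[OF assms] by auto
qed

end
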